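(* Let $y \in \mathbb{R}^n$, $X \in \mathbb{R}^{n\times p}$, $\lambda \ge 0$, and let $B$ be a real matrix with $p$ columns. Define $F:\mathbb{R}^p\to\mathbb{R}$ by $$F(\beta) = \frac{1}{2n}\|y - X\beta\|_2^2 + \lambda\,\Phi_B(\beta),$$ where $\Phi_B$ is the group GMC penalty. If $X^{\mathsf T}X \succeq \lambda B^{\mathsf T}B$, then $F$ is a convex function.
   Context: The $p$ coordinates are partitioned into $J$ groups of sizes $p_1,\dots,p_J$ with $\sum_{j=1}^J p_j = p$, and we write $\beta = (\beta_1^{\mathsf T},\dots,\beta_J^{\mathsf T})^{\mathsf T}\in\mathbb{R}^p$ with $\beta_j\in\mathbb{R}^{p_j}$ (similarly for $v\in\mathbb{R}^p$). $K_1,\dots,K_J$ are nonnegative weights. For a real matrix $B$ with $p$ columns, the group GMC (generalized minimax concave) penalty $\Phi_B:\mathbb{R}^p\to\mathbb{R}$ is $$\Phi_B(\beta) = \sum_{j=1}^J K_j\|\beta_j\|_2 - \min_{v\in\mathbb{R}^p}\left\{\sum_{j=1}^J K_j\|v_j\|_2 + \frac{1}{2n}\|B(\beta - v)\|_2^2\right\}.$$ $M\succeq N$ means that $M-N$ is positive semidefinite. *)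

theory Defs
  imports "HOL-Analysis.Analysis"
begin

definition psd :: "real^'n^'n \<Rightarrow> bool" where
  "psd M \<longleftrightarrow> transpose M = M \<and> (\<forall>x. 0 \<le> x \<bullet> (M *v x))"

definition loewner_ge :: "real^'n^'n \<Rightarrow> real^'n^'n \<Rightarrow> bool" (infix "\<succeq>" 50) where
  "M \<succeq> N \<longleftrightarrow> psd (M - N)"

text \<open>A partition of the coordinates into groups is given by the map \<open>g\<close> that sends a
  coordinate to the index of its group.\<close>

definition group_norm :: "('p::finite \<Rightarrow> 'j) \<Rightarrow> 'j \<Rightarrow> real^'p \<Rightarrow> real" where
  "group_norm g j \<beta> = L2_set (\<lambda>i. \<beta> $ i) {i. g i = j}"

definition group_penalty ::
    "('p::finite \<Rightarrow> 'j::finite) \<Rightarrow> ('j \<Rightarrow> real) \<Rightarrow> real^'p \<Rightarrow> real" where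
  "group_penalty g K \<beta> = (\<Sum>j\<in>UNIV. K j * group_norm g j \<beta>)"

definition gmc_inner ::
    "nat \<Rightarrow> ('p::finite \<Rightarrow> 'j::finite) \<Rightarrow> ('j \<Rightarrow> real) \<Rightarrow> real^'p^'m
      \<Rightarrow> real^'p \<Rightarrow> real^'p \<Rightarrow> real" where
  "gmc_inner n g K B \<beta> v =
     group_penalty g K v + 1 / (2 * real n) * (norm (B *v (\<beta> - v)))\<^sup>2"

text \<open>The minimum over \<open>v\<close> is the least element of the range. It exists for nonnegative
  weights, even when some of them vanish or \<open>B\<close> is singular: see
  \<open>gmc_inner_attains_min\<close> below.\<close>

definition group_gmc ::
    "nat \<Rightarrow> ('p::finite \<Rightarrow> 'j::finite) \<Rightarrow> ('j \<Rightarrow> real) \<Rightarrow> real^'p^'m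
      \<Rightarrow> real^'p \<Rightarrow> real" where
  "group_gmc n g K B \<beta> =
     group_penalty g K \<beta> - (LEAST m. m \<in> range (gmc_inner n g K B \<beta>))"

lemma gmc_inner_attains_min:
  fixes B :: "real^'p^'m" and g :: "'p::finite \<Rightarrow> 'j::finite"
  assumes K: "\<And>j. K j \<ge> 0" and n: "n > 0"
  shows "\<exists>v. \<forall>w. gmc_inner n g K B \<beta> v \<le> gmc_inner n g K B \<beta> w"
proof -
  define c where "c = 1 / (2 * real n)"
  have c: "c > 0" using n by (simp add: c_def)
  define L where "L = (\<lambda>v::real^'p. ((\<chi> i. K (g i) * v $ i) :: real^'p, B *v v))"
  define G where "G = (\<lambda>(a::real^'p, b).
    (\<Sum>j\<in>UNIV. group_norm g j a) + c * (norm (B *v \<beta> - b))\<^sup>2)"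
  have gn: "group_norm g j (\<chi> i. K (g i) * v $ i) = K j * group_norm g j v" for j v
  proof -
    have "group_norm g j (\<chi> i. K (g i) * v $ i) = L2_set (\<lambda>i. K j * v $ i) {i. g i = j}"
      unfolding group_norm_def by (rule L2_set_cong) auto
    also have "\<dots> = K j * group_norm g j v"
      unfolding group_norm_def by (rule L2_set_right_distrib[OF K, symmetric])
    finally show ?thesis .
  qed
  have GL: "gmc_inner n g K B \<beta> v = G (L v)" for v
    by (simp add: gmc_inner_def group_penalty_def G_def L_def gn c_def
        matrix_vector_mult_diff_distrib)
  have linL: "linear L"
    by (rule linearI)
      (auto simp: L_def vec_eq_iff algebra_simps matrix_vector_mult_scaleR)
  have clL: "closed (range L)"
    using linL by (intro closed_subspace linear_subspace_image subspace_UNIV)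
  have contG: "continuous_on UNIV G"
    unfolding G_def group_norm_def L2_set_def case_prod_unfold
    by (intro continuous_intros)
  have aG: "norm a \<le> G (a, b)" for a b
  proof -
    have "norm a \<le> (\<Sum>j\<in>UNIV. group_norm g j a)"
    proof -
      have gnn: "0 \<le> group_norm g j a" for j by (simp add: group_norm_def L2_set_nonneg)
      have "(norm a)\<^sup>2 = (\<Sum>i\<in>UNIV. (a $ i)\<^sup>2)"
        by (simp add: norm_vec_def L2_set_def sum_nonneg)
      also have "\<dots> = (\<Sum>j\<in>UNIV. \<Sum>i\<in>{i. g i = j}. (a $ i)\<^sup>2)"
        using sum.group[of UNIV UNIV g "\<lambda>i. (a $ i)\<^sup>2"] by simp
      also have "\<dots> = (\<Sum>j\<in>UNIV. (group_norm g j a)\<^sup>2)"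
        by (simp add: group_norm_def L2_set_def sum_nonneg)
      finally have "norm a = L2_set (\<lambda>j. group_norm g j a) UNIV"
        by (simp add: L2_set_def real_sqrt_unique)
      also have "\<dots> \<le> (\<Sum>j\<in>UNIV. group_norm g j a)"
        by (rule L2_set_le_sum) (simp add: gnn)
      finally show ?thesis .
    qed
    then show ?thesis using c by (simp add: G_def add_increasing2)
  qed
  have bG: "c * (norm (B *v \<beta> - b))\<^sup>2 \<le> G (a, b)" for a b
    by (simp add: G_def group_norm_def L2_set_nonneg sum_nonneg)
  define M where "M = G (L 0)"
  define R where "R = M + (norm (B *v \<beta>) + sqrt (M / c))"
  define S where "S = range L \<inter> cball 0 R"
  have small: "x \<in> cball 0 R" if "G x \<le> M" for x
  proof -
    obtain a b where x: "x = (a, b)" by force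
    have a: "norm a \<le> M" using aG[of a b] that x by simp
    have "(norm (B *v \<beta> - b))\<^sup>2 \<le> M / c"
      using bG[of b a] that x c by (simp add: field_simps)
    then have "norm (B *v \<beta> - b) \<le> sqrt (M / c)" by (rule real_le_rsqrt)
    moreover have "norm b \<le> norm (B *v \<beta>) + norm (B *v \<beta> - b)"
      using norm_triangle_ineq4[of "B *v \<beta>" "B *v \<beta> - b"] by simp
    ultimately have "norm a + norm b \<le> R" using a by (simp add: R_def)
    then show ?thesis using norm_Pair_le[of a b] x by simp
  qed
  have L0: "L 0 \<in> S" using small[of "L 0"] by (simp add: S_def M_def)
  have "compact S" unfolding S_def using clL by (simp add: closed_Int_compact)
  then obtain s where s: "s \<in> S" "\<And>t. t \<in> S \<Longrightarrow> G s \<le> G t"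
    using continuous_attains_inf[of S G] L0 contG continuous_on_subset[of UNIV G S] by blast
  then obtain v where v: "s = L v" by (auto simp: S_def)
  have "G (L v) \<le> G (L w)" for w
  proof (cases "G (L w) \<le> M")
    case True
    then show ?thesis using s(2)[of "L w"] small v by (simp add: S_def)
  next
    case False
    then show ?thesis using s(2)[OF L0] v by (simp add: M_def)
  qed
  then show ?thesis by (auto simp: GL)
qed

end

theory Submission
  imports Defs
begin

text \<open>Subtracting a minimum turns it into a maximum, so \<open>F\<close> is the pointwise maximum over \<open>v\<close> of
  the functions obtained by fixing \<open>v\<close> in the inner problem. Each of these is a nonnegative
  combination of group norms plus a quadratic function with Hessian
  \<open>(X\<^sup>T X - \<lambda> B\<^sup>T B) / n\<close>, hence convex.\<close>

lemma inner_gram_matrix: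
  fixes A :: "real^'n^'m"
  shows "x \<bullet> ((transpose A ** A) *v x) = (norm (A *v x))\<^sup>2"
  by (metis dot_lmul_matrix inner_commute matrix_vector_mul_assoc power2_norm_eq_inner
      transpose_matrix_vector)

text \<open>Extracts what convexity requires from the matrix inequality: evaluating the difference
  of the Gram matrices at \<open>x\<close> gives a comparison of two quadratic forms.\<close>

lemma loewner_ge_gramD:
  fixes X :: "real^'p^'n" and B :: "real^'p^'m"
  assumes "transpose X ** X \<succeq> c *\<^sub>R (transpose B ** B)"
  shows "c * (norm (B *v x))\<^sup>2 \<le> (norm (X *v x))\<^sup>2"
proof -
  have "0 \<le> x \<bullet> ((transpose X ** X - c *\<^sub>R (transpose B ** B)) *v x)"
    using assms by (simp add: loewner_ge_def psd_def)
  also have "\<dots> = (norm (X *v x))\<^sup>2 - c * (norm (B *v x))\<^sup>2"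
    by (simp add: matrix_vector_mult_diff_rdistrib inner_diff_right inner_gram_matrix
        flip: scaleR_matrix_vector_assoc)
  finally show ?thesis by simp
qed

text \<open>An identity instead of the usual inequality: with the convexity gap of the squared norm
  known exactly, a subtracted square can be handled too.\<close>

lemma norm_sq_convex_combination:
  fixes x y :: "'a::real_inner"
  shows "(norm ((1 - t) *\<^sub>R x + t *\<^sub>R y))\<^sup>2
    = (1 - t) * (norm x)\<^sup>2 + t * (norm y)\<^sup>2 - t * (1 - t) * (norm (x - y))\<^sup>2"
  unfolding power2_norm_eq_inner
  by (simp add: inner_simps inner_commute[of y x]) algebra

text \<open>The offsets \<open>a\<close> and \<open>b\<close> cancel in the convexity gaps. The gap
  of the difference is \<open>t * (1 - t)\<close> times the difference of the two quadratic forms at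
  \<open>x - y\<close>, which is nonnegative by \<open>le\<close>.\<close>

lemma convex_on_diff_norm_sq:
  fixes f :: "'a::real_vector \<Rightarrow> 'b::real_inner" and h :: "'a \<Rightarrow> 'c::real_inner"
  assumes f: "linear f" and h: "linear h"
    and le: "\<And>x. c * (norm (h x))\<^sup>2 \<le> (norm (f x))\<^sup>2"
  shows "convex_on UNIV (\<lambda>x. (norm (a - f x))\<^sup>2 - c * (norm (h (x - b)))\<^sup>2)"
proof (rule convex_onI)
  fix t :: real and x y :: 'a
  assume t: "0 < t" "t < 1"
  let ?z = "(1 - t) *\<^sub>R x + t *\<^sub>R y"
  \<comment> \<open>The weights sum to one, so the constant \<open>a\<close> splits along the
    combination.\<close>
  have "a - f ?z = (1 - t) *\<^sub>R (a - f x) + t *\<^sub>R (a - f y)"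
    by (simp add: linear_add[OF f] linear_diff[OF f] linear_scale[OF f] algebra_simps)
  then have F: "(norm (a - f ?z))\<^sup>2 = (1 - t) * (norm (a - f x))\<^sup>2 + t * (norm (a - f y))\<^sup>2
      - t * (1 - t) * (norm (f (x - y)))\<^sup>2"
    by (simp add: norm_sq_convex_combination linear_diff[OF f] norm_minus_commute)
  have "h (?z - b) = (1 - t) *\<^sub>R h (x - b) + t *\<^sub>R h (y - b)"
    by (simp add: linear_add[OF h] linear_diff[OF h] linear_scale[OF h] algebra_simps)
  then have H: "(norm (h (?z - b)))\<^sup>2 = (1 - t) * (norm (h (x - b)))\<^sup>2 + t * (norm (h (y - b)))\<^sup>2
      - t * (1 - t) * (norm (h (x - y)))\<^sup>2"
    by (simp add: norm_sq_convex_combination linear_diff[OF h])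
  have "t * (1 - t) * (c * (norm (h (x - y)))\<^sup>2) \<le> t * (1 - t) * (norm (f (x - y)))\<^sup>2"
    using t le by (intro mult_left_mono) auto
  then show "(norm (a - f ?z))\<^sup>2 - c * (norm (h (?z - b)))\<^sup>2
      \<le> (1 - t) * ((norm (a - f x))\<^sup>2 - c * (norm (h (x - b)))\<^sup>2)
        + t * ((norm (a - f y))\<^sup>2 - c * (norm (h (y - b)))\<^sup>2)"
    unfolding F H by (simp add: algebra_simps)
qed simp

lemma convex_on_group_norm: "convex_on UNIV (group_norm g j)"
proof (rule convex_onI)
  fix t :: real and x y :: "real^'a"
  assume t: "0 < t" "t < 1"
  have "group_norm g j ((1 - t) *\<^sub>R x + t *\<^sub>R y)
      \<le> L2_set (\<lambda>i. (1 - t) * x $ i) {i. g i = j} + L2_set (\<lambda>i. t * y $ i) {i. g i = j}"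
    by (simp add: group_norm_def L2_set_triangle_ineq)
  also have "\<dots> = (1 - t) * group_norm g j x + t * group_norm g j y"
    using t by (simp add: group_norm_def L2_set_right_distrib)
  finally show "group_norm g j ((1 - t) *\<^sub>R x + t *\<^sub>R y)
      \<le> (1 - t) * group_norm g j x + t * group_norm g j y" .
qed simp

lemma convex_on_group_penalty:
  assumes "\<And>j. K j \<ge> 0"
  shows "convex_on UNIV (group_penalty g K)"
proof -
  \<comment> \<open>Generalized from \<open>UNIV\<close> to any finite \<open>J\<close> so that
    induction on finite sets applies.\<close>
  have "convex_on UNIV (\<lambda>\<beta>. \<Sum>j\<in>J. K j * group_norm g j \<beta>)" if "finite J" for J
    using that
    by induction (auto intro!: convex_on_add convex_on_cmul convex_on_group_norm assms
        simp: convex_on_const)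
  then show ?thesis
    unfolding group_penalty_def by simp
qed

text \<open>\<open>LEAST\<close> on the reals is only informative when a least element exists, so
  the penalty is evaluated through a given minimizer \<open>v\<close>.\<close>

lemma group_gmc_eq:
  assumes "\<And>w. gmc_inner n g K B \<beta> v \<le> gmc_inner n g K B \<beta> w"
  shows "group_gmc n g K B \<beta> = group_penalty g K \<beta> - gmc_inner n g K B \<beta> v"
proof -
  have "(LEAST m. m \<in> range (gmc_inner n g K B \<beta>)) = gmc_inner n g K B \<beta> v"
    using assms by (intro Least_equality) auto
  then show ?thesis by (simp add: group_gmc_def)
qed

text \<open>The index attaining the maximum at the intermediate point is used at both endpoints:
  \<open>q v\<close> equals \<open>F\<close> at the former and lies below \<open>F\<close> at the
  latter.\<close>

lemma convex_on_attained_max: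
  assumes conv: "\<And>v. convex_on S (q v)"
    and ge: "\<And>v x. x \<in> S \<Longrightarrow> q v x \<le> F x"
    and att: "\<And>x. x \<in> S \<Longrightarrow> \<exists>v. F x = q v x"
  shows "convex_on S F"
proof (rule convex_onI)
  show S: "convex S" using conv convex_on_imp_convex by blast
  fix t :: real and x y
  assume t: "0 < t" "t < 1" and xy: "x \<in> S" "y \<in> S"
  let ?z = "(1 - t) *\<^sub>R x + t *\<^sub>R y"
  have "?z \<in> S" using t xy by (intro convexD[OF S]) auto
  then obtain v where "F ?z = q v ?z" using att by blast
  also have "\<dots> \<le> (1 - t) * q v x + t * q v y"
    using t xy by (intro convex_onD[OF conv]) auto
  also have "\<dots> \<le> (1 - t) * F x + t * F y"
    using t xy ge by (intro add_mono mult_left_mono) auto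
  finally show "F ?z \<le> (1 - t) * F x + t * F y" .
qed

theorem proposition2p1:
  fixes y :: "real^'n" and X :: "real^'p^'n" and B :: "real^'p^'m"
    and g :: "'p::finite \<Rightarrow> 'j::finite" and K :: "'j \<Rightarrow> real" and lam :: real
  assumes "\<And>j. K j \<ge> 0"
    and "lam \<ge> 0"
    and "transpose X ** X \<succeq> lam *\<^sub>R (transpose B ** B)"
  shows "convex_on UNIV (\<lambda>\<beta>. 1 / (2 * real CARD('n)) * (norm (y - X *v \<beta>))\<^sup>2
           + lam * group_gmc CARD('n) g K B \<beta>)"
proof -
  let ?c = "1 / (2 * real CARD('n))"
  let ?I = "gmc_inner CARD('n) g K B"
  let ?q = "\<lambda>v \<beta>. ?c * (norm (y - X *v \<beta>))\<^sup>2 + lam * (group_penalty g K \<beta> - ?I \<beta> v)"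
  show ?thesis
  proof (rule convex_on_attained_max[where q = ?q])
    fix v
    \<comment> \<open>This is \<open>?q v\<close> regrouped: the two squares share the factor
      \<open>?c\<close>, and the penalty at the fixed \<open>v\<close> is a constant, so its
      negative sign is harmless.\<close>
    have "convex_on UNIV (\<lambda>\<beta>. ?c * ((norm (y - X *v \<beta>))\<^sup>2 - lam * (norm (B *v (\<beta> - v)))\<^sup>2)
        + (lam * group_penalty g K \<beta> + - (lam * group_penalty g K v)))"
      using assms
      by (intro convex_on_add convex_on_cmul convex_on_diff_norm_sq convex_on_group_penalty
          convex_on_const[THEN iffD2] matrix_vector_mul_linear loewner_ge_gramD) auto
    then show "convex_on UNIV (?q v)"
      by (simp add: gmc_inner_def algebra_simps)
  next
    fix v \<beta>
    obtain w where w: "\<And>u. ?I \<beta> w \<le> ?I \<beta> u"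
      using gmc_inner_attains_min[of K "CARD('n)" g B \<beta>] assms(1) by auto
    \<comment> \<open>The inner problem enters \<open>?q\<close> with factor \<open>- lam\<close>,
      so its minimizer \<open>w\<close> maximizes \<open>?q\<close> over the index.\<close>
    have "lam * ?I \<beta> w \<le> lam * ?I \<beta> v" using w assms(2) by (rule mult_left_mono)
    then show "?q v \<beta> \<le> ?c * (norm (y - X *v \<beta>))\<^sup>2 + lam * group_gmc CARD('n) g K B \<beta>"
      by (simp add: group_gmc_eq[OF w] right_diff_distrib)
  next
    fix \<beta>
    obtain w where w: "\<And>u. ?I \<beta> w \<le> ?I \<beta> u"
      using gmc_inner_attains_min[of K "CARD('n)" g B \<beta>] assms(1) by auto
    show "\<exists>v. ?c * (norm (y - X *v \<beta>))\<^sup>2 + lam * group_gmc CARD('n) g K B \<beta> = ?q v \<beta>"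
      using group_gmc_eq[OF w] by auto
  qed
qed

end
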